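(* Let $\mathbb{K}\in\{\mathbb{R},\mathbb{C},\mathbb{H}\}$, let $G=O(n,\mathbb{K})$, let $X\in\mathcal{M}(n,\mathbb{K})$ be an arbitrary matrix, and let $h_X\colon G\to\mathbb{R}$, $h_X(A)=\Re\mathrm{Tr}(XA)$, be the corresponding height function. Let $\Sigma$ be the set of critical points of $h_X$, and let $A\in\Sigma$. Let $S(A)$ be the real vector space $$S(A)=\{\beta_0\in T_{A^*}G \colon XA\beta_0+\beta_0AX=0\}.$$ Then the Cayley map $$c_{A^*}\colon S(A)\to \Sigma\cap\Omega_G(A)$$ is a diffeomorphism.
   Context: $\mathcal{M}(n,\mathbb{K})$ is the space of $n\times n$ matrices over $\mathbb{K}$, and $A^*$ denotes the conjugate transpose. $O(n,\mathbb{K})=\{A\in\mathcal{M}(n,\mathbb{K})\colon AA^*=I\}$ (that is, $O(n)$, $U(n)$ or $Sp(n)$ according to $\mathbb{K}=\mathbb{R},\mathbb{C},\mathbb{H}$). For $A\in G=O(n,\mathbb{K})$, the tangent space is $T_AG=\{Y\in\mathcal{M}(n,\mathbb{K})\colon A^*Y+Y^*A=0\}$; $\Omega(A)$ is the open set of matrices $Y\in\mathcal{M}(n,\mathbb{K})$ such that $A+Y$ is invertible; $\Omega_G(A)=\Omega(A)\cap G$. The Cayley transform centered at $A$ is the map $c_A\colon\Omega(A)\to\Omega(A^* )$, $c_A(Y)=(I-A^*Y)(A+Y)^{-1}$; thus $c_{A^*}(Y)=(I-AY)(A^*+Y)^{-1}$. $\Re\mathrm{Tr}$ denotes the real part of the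 trace. *)

theory Defs
  imports "HOL-Analysis.Analysis"
begin

section \<open>Quaternions\<close>

datatype quat = Quat (quat_re: real) (quat_i: real) (quat_j: real) (quat_k: real)

lemma quat_eq_iff:
  "x = y \<longleftrightarrow> quat_re x = quat_re y \<and> quat_i x = quat_i y \<and> quat_j x = quat_j y \<and> quat_k x = quat_k y"
  by (cases x; cases y) simp

instantiation quat :: ring_1
begin

definition zero_quat_def: "0 = Quat 0 0 0 0"

definition one_quat_def: "1 = Quat 1 0 0 0"

definition plus_quat_def:
  "x + y = Quat (quat_re x + quat_re y) (quat_i x + quat_i y) (quat_j x + quat_j y) (quat_k x + quat_k y)"

definition minus_quat_def:
  "x - y = Quat (quat_re x - quat_re y) (quat_i x - quat_i y) (quat_j x - quat_j y) (quat_k x - quat_k y)"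

definition uminus_quat_def:
  "- x = Quat (- quat_re x) (- quat_i x) (- quat_j x) (- quat_k x)"

definition times_quat_def:
  "x * y = Quat
    (quat_re x * quat_re y - quat_i x * quat_i y - quat_j x * quat_j y - quat_k x * quat_k y)
    (quat_re x * quat_i y + quat_i x * quat_re y + quat_j x * quat_k y - quat_k x * quat_j y)
    (quat_re x * quat_j y - quat_i x * quat_k y + quat_j x * quat_re y + quat_k x * quat_i y)
    (quat_re x * quat_k y + quat_i x * quat_j y - quat_j x * quat_i y + quat_k x * quat_re y)"

instance
  by standard
    (simp_all add: quat_eq_iff zero_quat_def one_quat_def plus_quat_def minus_quat_def
      uminus_quat_def times_quat_def algebra_simps)

end

lemma quat_zero_simps [simp]:
  "quat_re 0 = 0" "quat_i 0 = 0" "quat_j 0 = 0" "quat_k 0 = 0"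
  by (simp_all add: zero_quat_def)

lemma quat_one_simps [simp]:
  "quat_re 1 = 1" "quat_i 1 = 0" "quat_j 1 = 0" "quat_k 1 = 0"
  by (simp_all add: one_quat_def)

lemma quat_plus_simps [simp]:
  "quat_re (x + y) = quat_re x + quat_re y" "quat_i (x + y) = quat_i x + quat_i y"
  "quat_j (x + y) = quat_j x + quat_j y" "quat_k (x + y) = quat_k x + quat_k y"
  by (simp_all add: plus_quat_def)

lemma quat_minus_simps [simp]:
  "quat_re (x - y) = quat_re x - quat_re y" "quat_i (x - y) = quat_i x - quat_i y"
  "quat_j (x - y) = quat_j x - quat_j y" "quat_k (x - y) = quat_k x - quat_k y"
  by (simp_all add: minus_quat_def)

lemma quat_uminus_simps [simp]:
  "quat_re (- x) = - quat_re x" "quat_i (- x) = - quat_i x"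
  "quat_j (- x) = - quat_j x" "quat_k (- x) = - quat_k x"
  by (simp_all add: uminus_quat_def)

lemma quat_times_simps [simp]:
  "quat_re (x * y) =
    quat_re x * quat_re y - quat_i x * quat_i y - quat_j x * quat_j y - quat_k x * quat_k y"
  "quat_i (x * y) =
    quat_re x * quat_i y + quat_i x * quat_re y + quat_j x * quat_k y - quat_k x * quat_j y"
  "quat_j (x * y) =
    quat_re x * quat_j y - quat_i x * quat_k y + quat_j x * quat_re y + quat_k x * quat_i y"
  "quat_k (x * y) =
    quat_re x * quat_k y + quat_i x * quat_j y - quat_j x * quat_i y + quat_k x * quat_re y"
  by (simp_all add: times_quat_def)

instantiation quat :: real_algebra_1
begin

definition scaleR_quat_def:
  "scaleR r x = Quat (r * quat_re x) (r * quat_i x) (r * quat_j x) (r * quat_k x)"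

instance
  by standard (simp_all add: quat_eq_iff scaleR_quat_def algebra_simps)

end

lemma quat_scaleR_simps [simp]:
  "quat_re (r *\<^sub>R x) = r * quat_re x" "quat_i (r *\<^sub>R x) = r * quat_i x"
  "quat_j (r *\<^sub>R x) = r * quat_j x" "quat_k (r *\<^sub>R x) = r * quat_k x"
  by (simp_all add: scaleR_quat_def)

lemma quat_of_real_simps [simp]:
  "quat_re (of_real r) = r" "quat_i (of_real r) = 0"
  "quat_j (of_real r) = 0" "quat_k (of_real r) = 0"
  by (simp_all add: of_real_def)

instantiation quat :: real_div_algebra
begin

definition inverse_quat_def:
  "inverse x = Quat (quat_re x) (- quat_i x) (- quat_j x) (- quat_k x) /\<^sub>R
    ((quat_re x)\<^sup>2 + (quat_i x)\<^sup>2 + (quat_j x)\<^sup>2 + (quat_k x)\<^sup>2)"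

definition divide_quat_def: "x div y = x * inverse (y :: quat)"

instance
proof
  fix x y :: quat
  define s where "s = (quat_re x)\<^sup>2 + (quat_i x)\<^sup>2 + (quat_j x)\<^sup>2 + (quat_k x)\<^sup>2"
  have inv: "inverse x = Quat (quat_re x) (- quat_i x) (- quat_j x) (- quat_k x) /\<^sub>R s"
    by (simp add: inverse_quat_def s_def)
  show "inverse x * x = 1" "x * inverse x = 1" if "x \<noteq> 0"
  proof -
    from that have "s \<noteq> 0"
      by (auto simp: s_def quat_eq_iff add_nonneg_eq_0_iff)
    then show "inverse x * x = 1" "x * inverse x = 1"
      by (simp_all add: inv quat_eq_iff field_simps)
        (simp_all add: s_def power2_eq_square algebra_simps)
  qed
  show "inverse (0::quat) = 0"
    by (simp add: inverse_quat_def quat_eq_iff)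
qed (rule divide_quat_def)

end

instantiation quat :: real_normed_div_algebra
begin

definition norm_quat_def:
  "norm x = sqrt ((quat_re x)\<^sup>2 + (quat_i x)\<^sup>2 + (quat_j x)\<^sup>2 + (quat_k x)\<^sup>2)"

definition sgn_quat_def: "sgn (x::quat) = x /\<^sub>R norm x"

definition dist_quat_def: "dist x y = norm (x - y :: quat)"

definition uniformity_quat_def [code del]:
  "(uniformity :: (quat \<times> quat) filter) = (INF e\<in>{0 <..}. principal {(x, y). dist x y < e})"

definition open_quat_def [code del]:
  "open (U :: quat set) \<longleftrightarrow> (\<forall>x\<in>U. eventually (\<lambda>(x', y). x' = x \<longrightarrow> y \<in> U) uniformity)"

instance
proof
  fix r :: real and x y :: quat
  have norm_zero: "norm z = 0 \<longleftrightarrow> z = 0" for z :: quat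
    by (auto simp: norm_quat_def quat_eq_iff add_nonneg_eq_0_iff)
  show "norm x = 0 \<longleftrightarrow> x = 0"
    by (rule norm_zero)
  have pair: "norm z = norm ((quat_re z, quat_i z), (quat_j z, quat_k z))" for z :: quat
    by (simp add: norm_quat_def norm_prod_def add.assoc)
  show "norm (x + y) \<le> norm x + norm y"
    using norm_triangle_ineq[of "((quat_re x, quat_i x), (quat_j x, quat_k x))"
        "((quat_re y, quat_i y), (quat_j y, quat_k y))"]
    by (simp add: pair)
  show "norm (r *\<^sub>R x) = \<bar>r\<bar> * norm x"
  proof -
    have "(norm (r *\<^sub>R x)) = sqrt (r\<^sup>2 * ((quat_re x)\<^sup>2 + (quat_i x)\<^sup>2 + (quat_j x)\<^sup>2 + (quat_k x)\<^sup>2))"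
      by (simp add: norm_quat_def power_mult_distrib algebra_simps)
    then show ?thesis
      by (simp add: norm_quat_def real_sqrt_mult)
  qed
  show "norm (x * y) = norm x * norm y"
    unfolding norm_quat_def real_sqrt_mult [symmetric] quat_times_simps
    by (rule arg_cong[where f = sqrt]) (simp add: power2_eq_square algebra_simps)
qed (rule sgn_quat_def dist_quat_def open_quat_def uniformity_quat_def)+

end

instantiation quat :: real_inner
begin

definition inner_quat_def:
  "inner x y = quat_re x * quat_re y + quat_i x * quat_i y + quat_j x * quat_j y + quat_k x * quat_k y"

instance
proof
  fix x y z :: quat and r :: real
  show "0 \<le> inner x x"
    by (simp add: inner_quat_def)
  show "inner x x = 0 \<longleftrightarrow> x = 0"
    by (auto simp: inner_quat_def quat_eq_iff add_nonneg_eq_0_iff)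
  show "norm x = sqrt (inner x x)"
    by (simp add: inner_quat_def norm_quat_def power2_eq_square)
qed (simp_all add: inner_quat_def algebra_simps)

end

instantiation quat :: euclidean_space
begin

definition Basis_quat_def:
  "Basis = {Quat 1 0 0 0, Quat 0 1 0 0, Quat 0 0 1 0, Quat 0 0 0 1}"

instance
proof
  fix u v x :: quat
  show "u \<in> Basis \<Longrightarrow> v \<in> Basis \<Longrightarrow> inner u v = (if u = v then 1 else 0)"
    unfolding Basis_quat_def inner_quat_def by (elim insertE emptyE; simp)
  show "(\<forall>u\<in>Basis. inner x u = 0) \<longleftrightarrow> x = 0"
    by (simp add: Basis_quat_def inner_quat_def quat_eq_iff[of x 0])
qed (simp_all add: Basis_quat_def)

end


section \<open>The three ground fields\<close>

text \<open>
  A common signature for the real numbers, the complex numbers and the quaternions, so that the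
  matrix notions below need to be defined only once.  The axioms are properties shared by the three
  instances.
\<close>

class conj_algebra = real_normed_div_algebra + euclidean_space +
  fixes conjugate :: "'a \<Rightarrow> 'a"
    and re_part :: "'a \<Rightarrow> real"
  assumes conj_add: "conjugate (x + y) = conjugate x + conjugate y"
    and conj_mult: "conjugate (x * y) = conjugate y * conjugate x"
    and conj_conj: "conjugate (conjugate x) = x"
    and conj_scaleR: "conjugate (r *\<^sub>R x) = r *\<^sub>R conjugate x"
    and mult_conj: "x * conjugate x = (norm x)\<^sup>2 *\<^sub>R 1"
    and add_conj: "x + conjugate x = (2 * re_part x) *\<^sub>R 1"
    and inner_eq_re_part: "inner x y = re_part (conjugate x * y)"

instantiation real :: conj_algebra
begin

definition conj_real_def: "conjugate (x::real) = x"

definition re_part_real_def: "re_part (x::real) = x"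

instance
  by standard (simp_all add: conj_real_def re_part_real_def power2_eq_square)

end

instantiation complex :: conj_algebra
begin

definition conj_complex_def: "conjugate z = cnj z"

definition re_part_complex_def: "re_part z = Re z"

instance
proof
  fix x :: complex
  show "x * conjugate x = (norm x)\<^sup>2 *\<^sub>R 1"
    by (simp add: conj_complex_def complex_norm_square[symmetric] scaleR_conv_of_real)
qed (simp_all add: conj_complex_def re_part_complex_def complex_eq_iff inner_complex_def)

end

instantiation quat :: conj_algebra
begin

definition conj_quat_def:
  "conjugate q = Quat (quat_re q) (- quat_i q) (- quat_j q) (- quat_k q)"

definition re_part_quat_def: "re_part q = quat_re q"

instance
proof
  fix x :: quat
  show "x * conjugate x = (norm x)\<^sup>2 *\<^sub>R 1"
    by (simp add: conj_quat_def quat_eq_iff power2_norm_eq_inner inner_quat_def)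
qed (simp_all add: conj_quat_def re_part_quat_def quat_eq_iff inner_quat_def algebra_simps)

end


section \<open>Smooth maps between subsets of Euclidean spaces\<close>

text \<open>
  Meaningful for open \<open>U\<close>: all iterated directional derivatives up to order \<open>k\<close> exist as Frechet
  derivatives and are continuous, which in finite dimension is the class of \<open>k\<close> times continuously
  differentiable maps.
\<close>

primrec k_times_differentiable_on ::
  "nat \<Rightarrow> ('a::euclidean_space \<Rightarrow> 'b::euclidean_space) \<Rightarrow> 'a set \<Rightarrow> bool"
where
  "k_times_differentiable_on 0 f U \<longleftrightarrow> continuous_on U f"
| "k_times_differentiable_on (Suc k) f U \<longleftrightarrow>
    (\<forall>x\<in>U. f differentiable (at x)) \<and>
    (\<forall>v. k_times_differentiable_on k (\<lambda>x. frechet_derivative f (at x) v) U)"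

text \<open>
  On an arbitrary subset, smooth means locally the restriction of a smooth map defined on an open
  set of the ambient space.  A set \<open>T\<close> that is diffeomorphic in this sense to a linear subspace is
  an embedded submanifold of the ambient space, and for embedded submanifolds the notion agrees
  with the intrinsic one.
\<close>

definition smooth_map_on :: "'a set \<Rightarrow> ('a::euclidean_space \<Rightarrow> 'b::euclidean_space) \<Rightarrow> bool"
  where "smooth_map_on S f \<longleftrightarrow>
    (\<forall>x\<in>S. \<exists>U g. open U \<and> x \<in> U \<and> (\<forall>k. k_times_differentiable_on k g U) \<and>
      (\<forall>y\<in>S \<inter> U. g y = f y))"

definition diffeomorphism_betw ::
  "('a::euclidean_space \<Rightarrow> 'b::euclidean_space) \<Rightarrow> 'a set \<Rightarrow> 'b set \<Rightarrow> bool"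
  where "diffeomorphism_betw f S T \<longleftrightarrow>
    bij_betw f S T \<and> smooth_map_on S f \<and> smooth_map_on T (inv_into S f)"


section \<open>Height functions and the Cayley transform\<close>

definition conj_transpose :: "'a::conj_algebra ^ 'n ^ 'm \<Rightarrow> 'a ^ 'm ^ 'n"
  where "conj_transpose A = (\<chi> i j. conjugate (A $ j $ i))"

definition orthogonal_group :: "('a::conj_algebra ^ 'n ^ 'n) set"
  where "orthogonal_group = {A. A ** conj_transpose A = mat 1}"

definition tangent_space :: "'a::conj_algebra ^ 'n ^ 'n \<Rightarrow> ('a ^ 'n ^ 'n) set"
  where "tangent_space A = {Y. conj_transpose A ** Y + conj_transpose Y ** A = 0}"

definition Omega :: "'a::conj_algebra ^ 'n ^ 'n \<Rightarrow> ('a ^ 'n ^ 'n) set"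
  where "Omega A = {Y. invertible (A + Y)}"

definition Omega_G :: "'a::conj_algebra ^ 'n ^ 'n \<Rightarrow> ('a ^ 'n ^ 'n) set"
  where "Omega_G A = Omega A \<inter> orthogonal_group"

text \<open>The value is meaningful only for \<open>Y \<in> Omega A\<close>.\<close>

definition cayley :: "'a::conj_algebra ^ 'n ^ 'n \<Rightarrow> 'a ^ 'n ^ 'n \<Rightarrow> 'a ^ 'n ^ 'n"
  where "cayley A Y = (mat 1 - conj_transpose A ** Y) ** matrix_inv (A + Y)"

definition height :: "'a::conj_algebra ^ 'n ^ 'n \<Rightarrow> 'a ^ 'n ^ 'n \<Rightarrow> real"
  where "height X A = re_part (trace (X ** A))"

text \<open>
  \<open>height X\<close> is defined on all matrices, so the differential at \<open>A\<close> of its restriction to the group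
  is the restriction to the tangent space of its Frechet derivative at \<open>A\<close>.
\<close>

definition critical_set :: "'a::conj_algebra ^ 'n ^ 'n \<Rightarrow> ('a ^ 'n ^ 'n) set"
  where "critical_set X =
    {A \<in> orthogonal_group. \<exists>D. (height X has_derivative D) (at A) \<and> (\<forall>Y\<in>tangent_space A. D Y = 0)}"

definition S_space ::
    "'a::conj_algebra ^ 'n ^ 'n \<Rightarrow> 'a ^ 'n ^ 'n \<Rightarrow> ('a ^ 'n ^ 'n) set"
  where "S_space X A =
    {B \<in> tangent_space (conj_transpose A). X ** A ** B + B ** A ** X = 0}"

end

theory Submission
  imports Defs
begin

text \<open>
  The whole argument works over any \<^class>\<open>conj_algebra\<close>. For orthogonal \<open>A\<close> one has
  \<open>A\<^sup>\<dagger> + c\<^sub>A Y = 2 (A + Y)\<^sup>-\<^sup>1\<close>, so the Cayley maps centred at \<open>A\<close> and \<open>A\<^sup>\<dagger>\<close> are mutually inverse. Let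
  \<open>N = A + Y\<close> and \<open>B = c\<^sub>A Y\<close>, so that \<open>B N = 1 - A\<^sup>\<dagger> Y\<close> and \<open>N B = 1 - Y A\<^sup>\<dagger>\<close>. Comparing
  \<open>(B N)\<^sup>\<dagger> (B N)\<close> with \<open>N\<^sup>\<dagger> N\<close> shows that \<open>B\<close> is orthogonal exactly if \<open>Y\<close> is tangent at \<open>A\<close>.
  Critical points of the height function are the orthogonal solutions of \<open>B X B = X\<^sup>\<dagger>\<close>; given one
  solution \<open>A\<^sup>\<dagger>\<close>, comparing \<open>(N B) X (B N)\<close> with \<open>N (A\<^sup>\<dagger> X A\<^sup>\<dagger>) N\<close> turns this quadratic equation into the
  linear one \<open>X A\<^sup>\<dagger> Y + Y A\<^sup>\<dagger> X = 0\<close>. Smoothness reduces to that of matrix inversion, whose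
  derivative at \<open>M\<close> is \<open>H \<mapsto> - M\<^sup>-\<^sup>1 H M\<^sup>-\<^sup>1\<close>.
\<close>

section \<open>Maps with iterated derivatives\<close>

lemma k_times_differentiable_on_Suc_D:
  "k_times_differentiable_on (Suc k) f U \<Longrightarrow> k_times_differentiable_on k f U"
proof (induction k arbitrary: f)
  case 0
  then show ?case
    by (auto intro!: differentiable_imp_continuous_on simp: differentiable_on_def differentiable_at_withinI)
next
  case (Suc k)
  then show ?case by auto
qed

text \<open>Agreement on an open set forces equal derivatives at each of its points, so the
  induction passes to the directional derivatives.\<close>

lemma k_times_differentiable_on_cong:
  assumes "open U" "\<And>x. x \<in> U \<Longrightarrow> f x = g x" "k_times_differentiable_on k f U"
  shows "k_times_differentiable_on k g U"
  using assms(2,3)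
proof (induction k arbitrary: f g)
  case 0
  then show ?case
    by (simp cong: continuous_on_cong)
next
  case (Suc k)
  have g: "(g has_derivative frechet_derivative f (at x)) (at x)" if "x \<in> U" for x
    using that Suc.prems \<open>open U\<close>
    by (metis frechet_derivative_works has_derivative_transform_within_open k_times_differentiable_on.simps(2))
  then have eq: "frechet_derivative f (at x) = frechet_derivative g (at x)" if "x \<in> U" for x
    using that frechet_derivative_at by blast
  have "k_times_differentiable_on k (\<lambda>x. frechet_derivative g (at x) v) U" for v
    using Suc.IH[of "\<lambda>x. frechet_derivative f (at x) v" "\<lambda>x. frechet_derivative g (at x) v"] Suc.prems(2) eq
    by simp
  with g show ?case
    by (auto simp: differentiable_def)
qed

text \<open>Uniqueness of derivatives identifies \<open>f'\<close> with
  \<open>frechet_derivative\<close> on \<open>U\<close>, so an explicit formula for the derivative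
  can be used in its place.\<close>

lemma k_times_differentiable_on_SucI:
  assumes "open U" "\<And>x. x \<in> U \<Longrightarrow> (f has_derivative f' x) (at x)"
    and "\<And>v. k_times_differentiable_on k (\<lambda>x. f' x v) U"
  shows "k_times_differentiable_on (Suc k) f U"
proof -
  have "f' x = frechet_derivative f (at x)" if "x \<in> U" for x
    using assms(2)[OF that] by (rule frechet_derivative_at)
  then have "k_times_differentiable_on k (\<lambda>x. frechet_derivative f (at x) v) U" for v
    by (intro k_times_differentiable_on_cong[OF assms(1) _ assms(3)[of v]]) auto
  then show ?thesis
    using assms(2) by (auto simp: differentiable_def)
qed

lemma k_times_differentiable_on_const:
  assumes "open U" shows "k_times_differentiable_on k (\<lambda>x. c) U"
proof (induction k arbitrary: c)
  case (Suc k)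
  show ?case
    by (rule k_times_differentiable_on_SucI[OF assms has_derivative_const Suc])
qed simp

lemma k_times_differentiable_on_linear:
  assumes "open U" "bounded_linear f"
  shows "k_times_differentiable_on k f U"
proof (cases k)
  case 0
  then show ?thesis
    using assms(2) by (simp add: linear_continuous_on)
next
  case (Suc l)
  then show ?thesis
    using k_times_differentiable_on_SucI[OF assms(1) bounded_linear_imp_has_derivative[OF assms(2)]
        k_times_differentiable_on_const[OF assms(1)]]
    by simp
qed

lemma k_times_differentiable_on_add:
  assumes "open U" "k_times_differentiable_on k f U" "k_times_differentiable_on k g U"
  shows "k_times_differentiable_on k (\<lambda>x. f x + g x) U"
  using assms(2,3)
proof (induction k arbitrary: f g)
  case (Suc k)
  show ?case
  proof (rule k_times_differentiable_on_SucI[OF assms(1)])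
    fix x assume "x \<in> U"
    then show "((\<lambda>x. f x + g x) has_derivative
        (\<lambda>v. frechet_derivative f (at x) v + frechet_derivative g (at x) v)) (at x)"
      using Suc.prems by (auto intro!: has_derivative_add simp: frechet_derivative_works)
  qed (use Suc in auto)
qed (auto intro: continuous_on_add)

text \<open>By the product rule the derivative is a sum of two terms of the same bilinear shape.
  Each still contains an undifferentiated factor, whose order is lowered by
  \<open>k_times_differentiable_on_Suc_D\<close>.\<close>

lemma k_times_differentiable_on_bilinear:
  assumes "open U" "bounded_bilinear p"
    and "k_times_differentiable_on k f U" "k_times_differentiable_on k g U"
  shows "k_times_differentiable_on k (\<lambda>x. p (f x) (g x)) U"
  using assms(3,4)
proof (induction k arbitrary: f g)
  case 0
  then show ?case
    using bounded_bilinear.continuous_on[OF assms(2)] by simp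
next
  case (Suc k)
  show ?case
  proof (rule k_times_differentiable_on_SucI[OF assms(1)])
    fix x assume "x \<in> U"
    then show "((\<lambda>x. p (f x) (g x)) has_derivative
        (\<lambda>v. p (f x) (frechet_derivative g (at x) v) + p (frechet_derivative f (at x) v) (g x))) (at x)"
      using Suc.prems by (auto intro!: bounded_bilinear.FDERIV[OF assms(2)] simp: frechet_derivative_works)
  next
    fix v
    show "k_times_differentiable_on k
        (\<lambda>x. p (f x) (frechet_derivative g (at x) v) + p (frechet_derivative f (at x) v) (g x)) U"
      using Suc.prems Suc.prems[THEN k_times_differentiable_on_Suc_D]
      by (intro k_times_differentiable_on_add[OF assms(1)] Suc.IH) auto
  qed
qed

section \<open>Matrix inversion over a finite-dimensional real algebra\<close>

lemma bounded_bilinear_matrix_mult: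
  "bounded_bilinear ((**) :: 'a::{euclidean_space,real_algebra_1}^'n^'m \<Rightarrow> 'a^'p^'n \<Rightarrow> 'a^'p^'m)"
  unfolding bilinear_conv_bounded_bilinear[symmetric] bilinear_def
  by (intro conjI allI linearI)
    (simp_all add: matrix_matrix_mult_def vec_eq_iff distrib_left distrib_right sum.distrib
      scaleR_sum_right)

lemma bounded_bilinear_matrix_vector_mult:
  "bounded_bilinear ((*v) :: 'a::{euclidean_space,real_algebra_1}^'n^'m \<Rightarrow> 'a^'n \<Rightarrow> 'a^'m)"
  unfolding bilinear_conv_bounded_bilinear[symmetric] bilinear_def
  by (intro conjI allI linearI)
    (simp_all add: matrix_vector_mult_def vec_eq_iff distrib_left distrib_right sum.distrib
      scaleR_sum_right)

text \<open>
  The entries need not commute, so there is no determinant; a dimension count over the reals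
  replaces it.
\<close>

lemma invertible_if_inj:
  fixes A :: "'a::{euclidean_space,real_algebra_1}^'n^'n"
  assumes "\<And>v. A *v v = 0 \<Longrightarrow> v = 0"
  shows "invertible A"
proof -
  have lin: "linear ((*v) M)" for M :: "'a^'n^'n"
    using bounded_bilinear.bounded_linear_right[OF bounded_bilinear_matrix_vector_mult]
    by (rule bounded_linear.linear)
  have inj: "inj ((*v) A)"
    using assms by (auto simp: linear_injective_0[OF lin])
  then have "surj ((*v) A)"
    using linear_injective_imp_surjective[OF lin] by auto
  then have "\<exists>x. A *v x = axis j 1" for j
    by (metis surjD)
  then obtain f where f: "A *v f j = axis j 1" for j
    by metis
  define B where "B = (\<chi> i j. f j $ i)"
  have "(A ** B) $ i $ j = (A *v f j) $ i" for i j
    by (simp add: matrix_matrix_mult_def matrix_vector_mult_def B_def)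
  then have AB: "A ** B = mat 1"
    by (simp add: f vec_eq_iff mat_def axis_def)
  have "A *v ((B ** A) *v x) = A *v x" for x
    by (simp add: matrix_vector_mul_assoc matrix_mul_assoc AB)
  then have "(B ** A) *v x = x" for x
    using inj by (auto dest: injD)
  then have "B ** A = mat 1"
    by (simp add: matrix_eq)
  with AB show ?thesis
    unfolding invertible_def by blast
qed

text \<open>The type-class product on \<open>'a^'n^'n\<close> is componentwise, so the ring laws for
  \<open>**\<close> are obtained by interpretation.\<close>

interpretation mat: ring
  where times = "(**) :: 'a::ring_1^'n^'n \<Rightarrow> 'a^'n^'n \<Rightarrow> 'a^'n^'n"
    and plus = "(+)" and minus = "(-)" and uminus = uminus and zero = 0
proof
  fix A B C :: "'a^'n^'n"
  show "A ** B ** C = A ** (B ** C)"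
    by (simp add: matrix_mul_assoc)
  show "(A + B) ** C = A ** C + B ** C"
    by (simp add: matrix_matrix_mult_def vec_eq_iff distrib_right sum.distrib)
  show "A ** (B + C) = A ** B + A ** C"
    by (rule matrix_add_ldistrib)
qed

section \<open>Perturbation and derivative of the matrix inverse\<close>

lemma matrix_inv_inverse:
  fixes A :: "'a::semiring_1^'n^'m"
  assumes "invertible A"
  shows "A ** matrix_inv A = mat 1" "matrix_inv A ** A = mat 1"
  using assms someI_ex[of "\<lambda>B. A ** B = mat 1 \<and> B ** A = mat 1"]
  by (auto simp: invertible_def matrix_inv_def)

text \<open>The resolvent identity. It yields both the Lipschitz bound for nearby inverses and the
  derivative of inversion.\<close>

lemma matrix_inv_diff:
  fixes M N :: "'a::ring_1^'n^'n"
  assumes "invertible M" "invertible N"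
  shows "matrix_inv N - matrix_inv M = - (matrix_inv N ** (N - M) ** matrix_inv M)"
proof -
  have "matrix_inv N ** M ** matrix_inv M = matrix_inv N"
    using matrix_inv_inverse(1)[OF assms(1)] by (simp flip: matrix_mul_assoc)
  then show ?thesis
    using matrix_inv_inverse(2)[OF assms(2)] by (simp add: mat.left_diff_distrib mat.right_diff_distrib)
qed

text \<open>A kernel vector \<open>v\<close> of \<open>N\<close> satisfies
  \<open>(I ** (N - M)) *v v = - v\<close> with \<open>I\<close> the inverse of \<open>M\<close>,
  which forces \<open>v = 0\<close> once \<open>N - M\<close> is small. The bound then comes from
  the resolvent identity.\<close>

lemma invertible_perturbation:
  fixes M :: "'a::{euclidean_space,real_algebra_1}^'n^'n"
  assumes "invertible M"
  obtains e C where "e > 0" "C \<ge> 0"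
    "\<And>N. norm (N - M) < e \<Longrightarrow> invertible N \<and> norm (matrix_inv N - matrix_inv M) \<le> C * norm (N - M)"
proof -
  obtain K where K: "K > 0" "\<And>(A :: 'a^'n^'n) (B :: 'a^'n^'n). norm (A ** B) \<le> norm A * norm B * K"
    using bounded_bilinear.pos_bounded[OF bounded_bilinear_matrix_mult] by blast
  obtain L where L: "L > 0" "\<And>(A :: 'a^'n^'n) v. norm (A *v v) \<le> norm A * norm v * L"
    using bounded_bilinear.pos_bounded[OF bounded_bilinear_matrix_vector_mult] by blast
  define I where "I = matrix_inv M"
  define c where "c = norm I + 1"
  \<comment> \<open>Chosen so that \<open>c * e * K * (K + L) = 1 / 2\<close>; the sum
    \<open>K + L\<close> serves the estimates with \<open>K\<close> and with \<open>L\<close> at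
    once. The summand \<open>1\<close> in \<open>c\<close> keeps \<open>c\<close> positive.\<close>
  define e where "e = 1 / (2 * c * K * (K + L))"
  have "c > 0"
    unfolding c_def by (simp add: add_nonneg_pos)
  then have "e > 0"
    using K(1) L(1) by (simp add: e_def)
  have small: "norm I * norm H * K * (K + L) \<le> 1 / 2" if "norm H < e" for H :: "'a^'n^'n"
  proof -
    have "norm I * norm H * K * (K + L) \<le> c * e * K * (K + L)"
      using that K(1) L(1) \<open>c > 0\<close> by (intro mult_mono mult_nonneg_nonneg) (auto simp: c_def e_def)
    also have "\<dots> = 1 / 2"
      using \<open>c > 0\<close> K(1) add_pos_pos[OF K(1) L(1)] by (simp add: e_def)
    finally show ?thesis .
  qed
  have smallK: "norm I * norm H * K * K \<le> 1 / 2" and smallL: "norm I * norm H * K * L \<le> 1 / 2"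
    if "norm H < e" for H :: "'a^'n^'n"
  proof -
    have "0 \<le> norm I * norm H * K * K" "0 \<le> norm I * norm H * K * L"
      using K(1) L(1) by simp_all
    with small[OF that] show "norm I * norm H * K * K \<le> 1 / 2" "norm I * norm H * K * L \<le> 1 / 2"
      unfolding distrib_left by linarith+
  qed
  have inv: "invertible N" if N: "norm (N - M) < e" for N
  proof (rule invertible_if_inj)
    fix v assume "N *v v = 0"
    then have "(I ** (N - M)) *v v = - v"
      using matrix_inv_inverse(2)[OF assms]
      by (simp add: I_def matrix_vector_mult_diff_rdistrib mat.right_diff_distrib flip: matrix_vector_mul_assoc)
    then have "norm v \<le> norm (I ** (N - M)) * norm v * L"
      using L(2)[of "I ** (N - M)" v] by simp
    also have "\<dots> \<le> (norm I * norm (N - M) * K) * norm v * L"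
      using K L(1) by (intro mult_right_mono) auto
    also have "\<dots> = (norm I * norm (N - M) * K * L) * norm v"
      by simp
    also have "\<dots> \<le> 1 / 2 * norm v"
      using smallL[OF N] by (intro mult_right_mono) auto
    finally show "v = 0"
      by simp
  qed
  have bound: "norm (matrix_inv N - I) \<le> norm (matrix_inv N) * (norm I * norm (N - M) * K * K)"
    if N: "norm (N - M) < e" for N
  proof -
    have "norm (matrix_inv N - I) = norm (matrix_inv N ** (N - M) ** I)"
      unfolding I_def matrix_inv_diff[OF assms inv[OF N]] by simp
    also have "\<dots> \<le> norm (matrix_inv N ** (N - M)) * norm I * K"
      by (rule K(2))
    also have "\<dots> \<le> (norm (matrix_inv N) * norm (N - M) * K) * norm I * K"
      using K by (intro mult_right_mono) auto
    finally show ?thesis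
      by (simp add: ac_simps)
  qed
  have "norm (matrix_inv N - I) \<le> (2 * c * c * K * K) * norm (N - M)" if N: "norm (N - M) < e" for N
  proof -
    \<comment> \<open>The bound still contains the unknown \<open>norm (matrix_inv N)\<close>; with
      factor \<open>1 / 2\<close> it can be absorbed, which bounds it by
      \<open>2 * c\<close>.\<close>
    have "norm (matrix_inv N - I) \<le> norm (matrix_inv N) * (1 / 2)"
      using bound[OF N] mult_left_mono[OF smallK[OF N], of "norm (matrix_inv N)"] by simp
    then have "norm (matrix_inv N) \<le> 2 * c"
      using norm_triangle_ineq2[of "matrix_inv N" I] by (simp add: c_def)
    then have "norm (matrix_inv N) * (norm I * norm (N - M) * K * K) \<le> 2 * c * (c * norm (N - M) * K * K)"
      using K(1) \<open>c > 0\<close> by (intro mult_mono) (auto simp: c_def)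
    with bound[OF N] show ?thesis
      by (simp add: ac_simps)
  qed
  with inv \<open>e > 0\<close> \<open>c > 0\<close> K(1) that[of e "2 * c * c * K * K"] show thesis
    unfolding I_def by auto
qed

lemma open_invertible: "open {M :: 'a::{euclidean_space,real_algebra_1}^'n^'n. invertible M}"
proof (simp add: open_dist, intro allI impI)
  fix M :: "'a^'n^'n" assume "invertible M"
  then show "\<exists>e>0. \<forall>N. dist N M < e \<longrightarrow> invertible N"
    unfolding dist_norm by (rule invertible_perturbation) blast
qed

text \<open>Subtracting the linear term from the resolvent identity leaves, up to sign,
  \<open>(matrix_inv N - ?I) ** (N - M) ** ?I\<close>. By the Lipschitz bound this is quadratic in
  \<open>norm (N - M)\<close>.\<close>

lemma has_derivative_matrix_inv:
  fixes M :: "'a::{euclidean_space,real_algebra_1}^'n^'n"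
  assumes "invertible M"
  shows "(matrix_inv has_derivative (\<lambda>H. - (matrix_inv M ** H ** matrix_inv M))) (at M)"
proof -
  let ?I = "matrix_inv M"
  obtain e C where e: "e > 0" "C \<ge> 0"
    "\<And>N. norm (N - M) < e \<Longrightarrow> invertible N \<and> norm (matrix_inv N - ?I) \<le> C * norm (N - M)"
    using invertible_perturbation[OF assms] by blast
  obtain K where K: "K > 0" "\<And>(A :: 'a^'n^'n) (B :: 'a^'n^'n). norm (A ** B) \<le> norm A * norm B * K"
    using bounded_bilinear.pos_bounded[OF bounded_bilinear_matrix_mult] by blast
  note bl = bounded_bilinear_matrix_mult
  have lin: "bounded_linear (\<lambda>H. - (?I ** H ** ?I))"
    using bounded_linear_compose[OF bounded_bilinear.bounded_linear_left[OF bl]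
        bounded_bilinear.bounded_linear_right[OF bl]]
    by (rule bounded_linear_minus)
  show ?thesis
  proof (rule has_derivativeI_sandwich[OF e(1) lin])
    fix N assume N: "N \<noteq> M" "dist N M < e"
    then have inv: "invertible N" and le: "norm (matrix_inv N - ?I) \<le> C * norm (N - M)"
      using e(3) by (auto simp: dist_norm)
    have "matrix_inv N - ?I - - (?I ** (N - M) ** ?I) = - ((matrix_inv N - ?I) ** (N - M) ** ?I)"
      by (subst (1) matrix_inv_diff[OF assms inv]) (simp add: mat.left_diff_distrib)
    then have "norm (matrix_inv N - ?I - - (?I ** (N - M) ** ?I)) = norm ((matrix_inv N - ?I) ** (N - M) ** ?I)"
      by (simp only: norm_minus_cancel)
    also have "\<dots> \<le> norm ((matrix_inv N - ?I) ** (N - M)) * norm ?I * K"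
      by (rule K(2))
    also have "\<dots> \<le> (norm (matrix_inv N - ?I) * norm (N - M) * K) * norm ?I * K"
      using K by (intro mult_right_mono) auto
    also have "\<dots> \<le> ((C * norm (N - M)) * norm (N - M) * K) * norm ?I * K"
      using K le by (intro mult_right_mono) auto
    finally show "norm (matrix_inv N - ?I - - (?I ** (N - M) ** ?I)) / norm (N - M)
        \<le> C * K * norm ?I * K * norm (N - M)"
      using N(1) by (simp add: divide_simps ac_simps)
  next
    have "((\<lambda>N. C * K * norm ?I * K * norm (N - M)) \<longlongrightarrow> C * K * norm ?I * K * norm (M - M)) (at M)"
      by (intro tendsto_intros)
    then show "((\<lambda>N. C * K * norm ?I * K * norm (N - M)) \<longlongrightarrow> 0) (at M)"
      by simp
  qed
qed

section \<open>Adjoints and critical points\<close>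

notation conj_transpose ("_\<^sup>\<dagger>" [1000] 1000)

section \<open>Conjugation in the ground field\<close>

lemma conj_0 [simp]: "conjugate (0 :: 'a::conj_algebra) = 0"
  using conj_scaleR[of 0 "0 :: 'a"] by simp

text \<open>Conjugating the product \<open>conjugate 1 * 1\<close> gives \<open>1\<close> directly,
  and \<open>conjugate 1\<close> by antimultiplicativity.\<close>

lemma conj_1 [simp]: "conjugate (1 :: 'a::conj_algebra) = 1"
  using conj_mult[of "conjugate 1" "1 :: 'a"] by (simp add: conj_conj)

lemma re_part_sum: "re_part (sum f S) = (\<Sum>i\<in>S. re_part (f i :: 'a::conj_algebra))"
  using inner_sum_right[of 1 f S] by (simp add: inner_eq_re_part)

lemma conj_minus: "conjugate (- x :: 'a::conj_algebra) = - conjugate x"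
  using conj_scaleR[of "- 1" x] by simp

lemma conj_sum: "conjugate (sum f S) = (\<Sum>i\<in>S. conjugate (f i :: 'a::conj_algebra))"
  by (induction S rule: infinite_finite_induct) (simp_all add: conj_add)

lemma norm_conj [simp]: "norm (conjugate x :: 'a::conj_algebra) = norm x"
proof (cases "x = 0")
  case False
  have "norm x * norm (conjugate x) = norm x * norm x"
    using arg_cong[OF mult_conj[of x], of norm] by (simp add: norm_mult power2_eq_square)
  with False show ?thesis
    by simp
qed simp

text \<open>Polarization: the inner product is determined by norms of sums, and conjugation is an
  additive isometry.\<close>

lemma inner_conj: "inner (conjugate x) (conjugate y :: 'a::conj_algebra) = inner x y"
  unfolding dot_norm conj_add[symmetric] norm_conj ..

lemma inner_mult_left: "inner (a * x) (y :: 'a::conj_algebra) = inner x (conjugate a * y)"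
  by (simp add: inner_eq_re_part conj_mult mult.assoc)

section \<open>The conjugate transpose as adjoint for the real inner product\<close>

lemma conj_transpose_conj_transpose [simp]: "A\<^sup>\<dagger>\<^sup>\<dagger> = A"
  by (simp add: conj_transpose_def vec_eq_iff conj_conj)

lemma conj_transpose_mult: "(A ** B)\<^sup>\<dagger> = B\<^sup>\<dagger> ** A\<^sup>\<dagger>"
  by (simp add: conj_transpose_def matrix_matrix_mult_def vec_eq_iff conj_sum conj_mult)

lemma conj_transpose_add: "(A + B)\<^sup>\<dagger> = A\<^sup>\<dagger> + B\<^sup>\<dagger>"
  by (simp add: conj_transpose_def vec_eq_iff conj_add)

lemma conj_transpose_minus: "(- A)\<^sup>\<dagger> = - A\<^sup>\<dagger>"
  by (simp add: conj_transpose_def vec_eq_iff conj_minus)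

lemma conj_transpose_diff: "(A - B)\<^sup>\<dagger> = A\<^sup>\<dagger> - B\<^sup>\<dagger>"
  using conj_transpose_add[of A "- B"] by (simp add: conj_transpose_minus)

lemma conj_transpose_scaleR: "(r *\<^sub>R A)\<^sup>\<dagger> = r *\<^sub>R A\<^sup>\<dagger>"
  by (simp add: conj_transpose_def vec_eq_iff conj_scaleR)

lemma conj_transpose_mat_1 [simp]: "(mat 1)\<^sup>\<dagger> = mat 1"
  by (simp add: conj_transpose_def mat_def vec_eq_iff)

lemmas conj_transpose_simps =
  conj_transpose_mult conj_transpose_add conj_transpose_minus conj_transpose_diff

lemma inner_conj_transpose: "inner (A\<^sup>\<dagger>) (B\<^sup>\<dagger>) = inner A B"
  unfolding inner_vec_def conj_transpose_def by (simp add: inner_conj) (rule sum.swap)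

lemma inner_matrix_mult_left: "inner (A ** B) C = inner B (A\<^sup>\<dagger> ** C)"
proof -
  let ?t = "\<lambda>i j k. inner (B $ j $ k) (conjugate (A $ i $ j) * C $ i $ k)"
  have "inner (A ** B) C = (\<Sum>i\<in>UNIV. \<Sum>k\<in>UNIV. \<Sum>j\<in>UNIV. ?t i j k)"
    by (simp add: inner_vec_def matrix_matrix_mult_def inner_sum_left inner_mult_left)
  also have "\<dots> = (\<Sum>i\<in>UNIV. \<Sum>j\<in>UNIV. \<Sum>k\<in>UNIV. ?t i j k)"
    by (intro sum.cong refl sum.swap)
  also have "\<dots> = (\<Sum>j\<in>UNIV. \<Sum>i\<in>UNIV. \<Sum>k\<in>UNIV. ?t i j k)"
    by (rule sum.swap)
  also have "\<dots> = (\<Sum>j\<in>UNIV. \<Sum>k\<in>UNIV. \<Sum>i\<in>UNIV. ?t i j k)"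
    by (intro sum.cong refl sum.swap)
  also have "\<dots> = inner B (A\<^sup>\<dagger> ** C)"
    by (simp add: inner_vec_def matrix_matrix_mult_def inner_sum_right conj_transpose_def)
  finally show ?thesis .
qed

lemma inner_matrix_vector_mult_left: "inner (A *v x) y = inner x (A\<^sup>\<dagger> *v y)"
proof -
  have "inner (A *v x) y = (\<Sum>i\<in>UNIV. \<Sum>j\<in>UNIV. inner (x $ j) (conjugate (A $ i $ j) * y $ i))"
    by (simp add: inner_vec_def matrix_vector_mult_def inner_sum_left inner_mult_left)
  also have "\<dots> = (\<Sum>j\<in>UNIV. \<Sum>i\<in>UNIV. inner (x $ j) (conjugate (A $ i $ j) * y $ i))"
    by (rule sum.swap)
  also have "\<dots> = inner x (A\<^sup>\<dagger> *v y)"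
    by (simp add: inner_vec_def matrix_vector_mult_def inner_sum_right conj_transpose_def)
  finally show ?thesis .
qed

section \<open>Height functions, the orthogonal group and critical points\<close>

lemma height_eq_inner: "height X = inner (X\<^sup>\<dagger>)"
proof
  fix A
  \<comment> \<open>Each summand \<open>re_part (x * a)\<close> is
    \<open>inner (conjugate x) a\<close>; the height function thus becomes a linear
    functional.\<close>
  have "height X A = (\<Sum>i\<in>UNIV. \<Sum>j\<in>UNIV. inner (conjugate (X $ i $ j)) (A $ j $ i))"
    by (simp add: height_def trace_def matrix_matrix_mult_def re_part_sum inner_eq_re_part conj_conj)
  also have "\<dots> = inner (X\<^sup>\<dagger>) A"
    unfolding inner_vec_def conj_transpose_def by simp (rule sum.swap)
  finally show "height X A = inner (X\<^sup>\<dagger>) A" .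
qed

text \<open>A one-sided inverse of a square matrix is two-sided: if \<open>A ** B = mat 1\<close>,
  then \<open>B\<close> has trivial kernel, hence an inverse, and that inverse must be
  \<open>A\<close>.\<close>

lemma orthogonal_group_iff: "A \<in> orthogonal_group \<longleftrightarrow> A\<^sup>\<dagger> ** A = mat 1"
proof -
  have *: "B ** A = mat 1" if "A ** B = mat 1" for A B :: "'a^'n^'n"
  proof -
    have "invertible B"
      by (rule invertible_if_inj) (metis matrix_vector_mul_assoc matrix_vector_mul_lid matrix_vector_mult_0_right that)
    then obtain C where C: "B ** C = mat 1" "C ** B = mat 1"
      unfolding invertible_def by blast
    have "A = A ** (B ** C)"
      using C by simp
    also have "\<dots> = C"
      using that by (simp add: matrix_mul_assoc)
    finally show ?thesis
      using C by simp
  qed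
  show ?thesis
    unfolding orthogonal_group_def using *[of A "A\<^sup>\<dagger>"] *[of "A\<^sup>\<dagger>" A] by auto
qed

lemma orthogonal_groupD:
  assumes "A \<in> orthogonal_group"
  shows "A ** A\<^sup>\<dagger> = mat 1" "A\<^sup>\<dagger> ** A = mat 1"
  using assms orthogonal_group_iff by (auto simp: orthogonal_group_def)

text \<open>The height function is linear and so is its own derivative; uniqueness of derivatives
  leaves no other choice of \<open>D\<close>.\<close>

lemma critical_set_iff_inner:
  "A \<in> critical_set X \<longleftrightarrow> A \<in> orthogonal_group \<and> (\<forall>Y\<in>tangent_space A. inner (X\<^sup>\<dagger>) Y = 0)"
proof -
  have *: "(height X has_derivative D) (at A) \<longleftrightarrow> D = inner (X\<^sup>\<dagger>)" for D
    using bounded_linear_imp_has_derivative[OF bounded_linear_inner_right, of "X\<^sup>\<dagger>" "at A"]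
      has_derivative_unique[of "height X" D A "inner (X\<^sup>\<dagger>)"]
    by (auto simp: height_eq_inner)
  show ?thesis
    by (auto simp: critical_set_def *)
qed

text \<open>Tangent vectors at \<open>A\<close> are the products \<open>A ** Z\<close> with
  \<open>Z\<close> skew, and pairing \<open>X\<^sup>\<dagger>\<close> with \<open>A ** Z\<close>
  equals pairing \<open>(X ** A)\<^sup>\<dagger>\<close> with \<open>Z\<close>. Criticality thus
  means orthogonality to all skew matrices, that is, self-adjointness.\<close>

lemma critical_set_iff_self_adjoint:
  "A \<in> critical_set X \<longleftrightarrow> A \<in> orthogonal_group \<and> (X ** A)\<^sup>\<dagger> = X ** A"
proof (cases "A \<in> orthogonal_group")
  case True
  note A = orthogonal_groupD[OF True]
  let ?W = "X ** A"
  have "(\<forall>Y\<in>tangent_space A. inner (X\<^sup>\<dagger>) Y = 0) \<longleftrightarrow> ?W\<^sup>\<dagger> = ?W"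
  proof
    assume crit: "\<forall>Y\<in>tangent_space A. inner (X\<^sup>\<dagger>) Y = 0"
    \<comment> \<open>Twice the skew part of \<open>?W\<^sup>\<dagger>\<close>: testing with
      \<open>A ** Z\<close> will give \<open>inner Z Z = 0\<close>.\<close>
    define Z where "Z = ?W\<^sup>\<dagger> - ?W"
    have Z: "Z\<^sup>\<dagger> = - Z"
      by (simp add: Z_def conj_transpose_diff)
    have "A\<^sup>\<dagger> ** (A ** Z) + (A ** Z)\<^sup>\<dagger> ** A = 0"
      using A Z by (simp add: matrix_mul_assoc conj_transpose_mult) (simp add: A flip: matrix_mul_assoc)
    then have "inner (X\<^sup>\<dagger>) (A ** Z) = 0"
      using crit by (simp add: tangent_space_def)
    then have "inner (?W\<^sup>\<dagger>) Z = 0"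
      by (simp add: conj_transpose_mult inner_commute[of _ Z] inner_commute[of _ "A ** Z"] inner_matrix_mult_left)
    moreover from this have "inner ?W Z = 0"
      using inner_conj_transpose[of ?W Z] by (simp add: Z)
    ultimately have "inner Z Z = 0"
      unfolding Z_def by (simp add: inner_diff_left)
    then show "?W\<^sup>\<dagger> = ?W"
      by (simp add: Z_def)
  next
    assume W: "?W\<^sup>\<dagger> = ?W"
    show "\<forall>Y\<in>tangent_space A. inner (X\<^sup>\<dagger>) Y = 0"
    proof
      fix Y assume "Y \<in> tangent_space A"
      then have Z: "(A\<^sup>\<dagger> ** Y)\<^sup>\<dagger> = - (A\<^sup>\<dagger> ** Y)"
        by (simp add: tangent_space_def conj_transpose_mult add_eq_0_iff)
      have "inner (X\<^sup>\<dagger>) Y = inner (X\<^sup>\<dagger>) (A ** (A\<^sup>\<dagger> ** Y))"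
        by (simp add: matrix_mul_assoc A)
      also have "\<dots> = inner (?W\<^sup>\<dagger>) (A\<^sup>\<dagger> ** Y)"
        by (simp add: conj_transpose_mult inner_commute[of "X\<^sup>\<dagger>"] inner_commute[of "A\<^sup>\<dagger> ** X\<^sup>\<dagger>"]
            inner_matrix_mult_left)
      finally have "inner (X\<^sup>\<dagger>) Y = inner (?W\<^sup>\<dagger>) (A\<^sup>\<dagger> ** Y)" .
      moreover have "inner (?W\<^sup>\<dagger>) (A\<^sup>\<dagger> ** Y) = - inner (?W\<^sup>\<dagger>) (A\<^sup>\<dagger> ** Y)"
        using inner_conj_transpose[of "?W" "A\<^sup>\<dagger> ** Y"] by (simp add: W Z)
      ultimately show "inner (X\<^sup>\<dagger>) Y = 0"
        by simp
    qed
  qed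
  with True show ?thesis
    by (simp add: critical_set_iff_inner)
qed (simp add: critical_set_def)

text \<open>Left multiplication by \<open>A\<close> or \<open>A\<^sup>\<dagger>\<close> passes
  between the two forms. The quadratic form is the one the Cayley transform linearizes.\<close>

lemma critical_set_iff:
  "A \<in> critical_set X \<longleftrightarrow> A \<in> orthogonal_group \<and> A ** X ** A = X\<^sup>\<dagger>"
proof (cases "A \<in> orthogonal_group")
  case True
  note A = orthogonal_groupD[OF True]
  have "A\<^sup>\<dagger> ** X\<^sup>\<dagger> = X ** A \<longleftrightarrow> A ** X ** A = X\<^sup>\<dagger>"
    by (metis A matrix_mul_assoc matrix_mul_lid)
  with True show ?thesis
    by (simp add: critical_set_iff_self_adjoint conj_transpose_mult)
qed (simp add: critical_set_def)

section \<open>The Cayley transform\<close>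

lemma open_Omega: "open (Omega A)"
proof -
  have "Omega A = (\<lambda>Y. A + Y) -` {M. invertible M}"
    by (auto simp: Omega_def)
  moreover have "open \<dots>"
    by (intro open_vimage open_invertible continuous_intros)
  ultimately show ?thesis
    by simp
qed

text \<open>The derivative of inversion is a product of inversion itself with constants, so each
  order of differentiability yields the next.\<close>

lemma k_times_differentiable_on_matrix_inv:
  "k_times_differentiable_on k (\<lambda>Y. matrix_inv (A + Y)) (Omega A)"
proof -
  \<comment> \<open>The sign is written as \<open>- 1 *\<^sub>R\<close> so that it falls under the
    product rule for \<open>scaleR\<close>.\<close>
  have deriv: "((\<lambda>Y. matrix_inv (A + Y)) has_derivative
      (\<lambda>H. - 1 *\<^sub>R (matrix_inv (A + Y) ** H ** matrix_inv (A + Y)))) (at Y)"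
    if "Y \<in> Omega A" for Y
  proof -
    have "((\<lambda>Y. A + Y) has_derivative (\<lambda>H. H)) (at Y)"
      by (auto intro!: derivative_eq_intros)
    from has_derivative_compose[OF this has_derivative_matrix_inv] that show ?thesis
      by (simp add: Omega_def)
  qed
  show ?thesis
  proof (induction k)
    case 0
    then show ?case
      using has_derivative_continuous_on[OF has_derivative_at_withinI[OF deriv]] by simp
  next
    case (Suc k)
    show ?case
    proof (rule k_times_differentiable_on_SucI[OF open_Omega deriv])
      show "k_times_differentiable_on k
          (\<lambda>Y. - 1 *\<^sub>R (matrix_inv (A + Y) ** H ** matrix_inv (A + Y))) (Omega A)" for H
        by (intro k_times_differentiable_on_bilinear[OF open_Omega bounded_bilinear_scaleR]
            k_times_differentiable_on_bilinear[OF open_Omega bounded_bilinear_matrix_mult]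
            k_times_differentiable_on_const open_Omega Suc)
    qed
  qed
qed

lemma k_times_differentiable_on_cayley: "k_times_differentiable_on k (cayley A) (Omega A)"
proof -
  have "bounded_linear (\<lambda>Y. - (conj_transpose A ** Y))"
    by (intro bounded_linear_minus bounded_bilinear.bounded_linear_right[OF bounded_bilinear_matrix_mult])
  then have "k_times_differentiable_on k (\<lambda>Y. mat 1 + - (conj_transpose A ** Y)) (Omega A)"
    by (intro k_times_differentiable_on_add k_times_differentiable_on_const
        k_times_differentiable_on_linear open_Omega)
  then have "k_times_differentiable_on k
      (\<lambda>Y. (mat 1 + - (conj_transpose A ** Y)) ** matrix_inv (A + Y)) (Omega A)"
    by (rule k_times_differentiable_on_bilinear[OF open_Omega bounded_bilinear_matrix_mult _
        k_times_differentiable_on_matrix_inv])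
  then show ?thesis
    by (simp add: cayley_def[abs_def])
qed

text \<open>A single extension, \<open>cayley A\<close> on the open set \<open>Omega A\<close>,
  serves every point of \<open>S\<close>. Asking only for agreement on \<open>S\<close> lets
  \<open>f\<close> be an \<open>inv_into\<close>.\<close>

lemma smooth_map_on_if_eq_cayley:
  assumes "S \<subseteq> Omega A" "\<And>Y. Y \<in> S \<Longrightarrow> f Y = cayley A Y"
  shows "smooth_map_on S f"
  unfolding smooth_map_on_def
proof (intro ballI exI[of _ "Omega A"] exI[of _ "cayley A"] conjI allI)
  show "Y \<in> Omega A" if "Y \<in> S" for Y
    using that assms(1) by blast
qed (simp_all add: open_Omega k_times_differentiable_on_cayley assms(2))

section \<open>Algebraic identities of the Cayley transform\<close>

lemma cayley_mult:
  assumes "Y \<in> Omega A"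
  shows "cayley A Y ** (A + Y) = mat 1 - A\<^sup>\<dagger> ** Y"
  using assms matrix_inv_inverse(2)[of "A + Y"]
  by (simp add: cayley_def Omega_def flip: matrix_mul_assoc)

lemma cayley_involution:
  assumes A: "A \<in> orthogonal_group" and Y: "Y \<in> Omega A"
  shows "cayley A Y \<in> Omega (A\<^sup>\<dagger>)" "cayley (A\<^sup>\<dagger>) (cayley A Y) = Y"
proof -
  define I where "I = matrix_inv (A + Y)"
  have I: "(A + Y) ** I = mat 1" "I ** (A + Y) = mat 1"
    using Y matrix_inv_inverse[of "A + Y"] by (auto simp: I_def Omega_def)
  note bl = bounded_bilinear.scaleR_left[OF bounded_bilinear_matrix_mult]
    bounded_bilinear.scaleR_right[OF bounded_bilinear_matrix_mult]
  have c: "cayley A Y = (mat 1 - A\<^sup>\<dagger> ** Y) ** I"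
    by (simp add: cayley_def I_def)
  \<comment> \<open>Inserting \<open>(A + Y) ** I = mat 1\<close> gives both summands the right
    factor \<open>I\<close>.\<close>
  have "A\<^sup>\<dagger> + cayley A Y = A\<^sup>\<dagger> ** ((A + Y) ** I) + (mat 1 - A\<^sup>\<dagger> ** Y) ** I"
    by (simp add: I c)
  also have "\<dots> = (A\<^sup>\<dagger> ** (A + Y) + (mat 1 - A\<^sup>\<dagger> ** Y)) ** I"
    by (simp only: matrix_mul_assoc mat.distrib_right[of "A\<^sup>\<dagger> ** (A + Y)"])
  also have "\<dots> = 2 *\<^sub>R I"
    using orthogonal_groupD[OF A] by (simp add: mat.distrib_left mat.distrib_right scaleR_2)
  finally have sum: "A\<^sup>\<dagger> + cayley A Y = 2 *\<^sub>R I" .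
  have inv: "2 *\<^sub>R I ** ((1/2) *\<^sub>R (A + Y)) = mat 1" "((1/2) *\<^sub>R (A + Y)) ** (2 *\<^sub>R I) = mat 1"
    by (simp_all add: bl I del: scaleR_add_right)
  then show \<Omega>: "cayley A Y \<in> Omega (A\<^sup>\<dagger>)"
    by (auto simp: Omega_def sum invertible_def)
  \<comment> \<open>The numerator of the second transform is \<open>Y\<close> times its denominator
    \<open>2 *\<^sub>R I\<close>, so cancelling the latter recovers \<open>Y\<close>.\<close>
  have Y_eq: "Y ** (2 *\<^sub>R I) = mat 1 - A ** cayley A Y"
  proof -
    have "mat 1 - A ** cayley A Y = (A + Y) ** I - A ** ((mat 1 - A\<^sup>\<dagger> ** Y) ** I)"
      by (simp add: I c)
    also have "\<dots> = (A + Y - (A - A ** A\<^sup>\<dagger> ** Y)) ** I"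
      by (simp add: matrix_mul_assoc mat.right_diff_distrib mat.left_diff_distrib mat.distrib_right)
    also have "\<dots> = Y ** (2 *\<^sub>R I)"
      using orthogonal_groupD[OF A] by (simp add: bl scaleR_2 mat.distrib_left mat.distrib_right)
    finally show ?thesis
      by simp
  qed
  have "cayley (A\<^sup>\<dagger>) (cayley A Y) ** (2 *\<^sub>R I) = Y ** (2 *\<^sub>R I)"
    using cayley_mult[OF \<Omega>] by (simp add: sum Y_eq)
  then have "cayley (A\<^sup>\<dagger>) (cayley A Y) ** (2 *\<^sub>R I) ** ((1/2) *\<^sub>R (A + Y))
      = Y ** (2 *\<^sub>R I) ** ((1/2) *\<^sub>R (A + Y))"
    by simp
  then show "cayley (A\<^sup>\<dagger>) (cayley A Y) = Y"
    by (simp only: inv matrix_mul_rid flip: matrix_mul_assoc)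
qed

lemma invertible_cancel:
  fixes N :: "'a::semiring_1^'n^'n"
  assumes "invertible N"
  shows "B ** N = C ** N \<longleftrightarrow> B = C" "N ** B = N ** C \<longleftrightarrow> B = C"
  by (metis assms invertible_def matrix_mul_assoc matrix_mul_lid matrix_mul_rid)+

lemma invertible_conj_transpose: "invertible A \<Longrightarrow> invertible (A\<^sup>\<dagger>)"
  by (metis conj_transpose_mat_1 conj_transpose_mult invertible_def)

lemma self_eq_minus_iff: "x = - x \<longleftrightarrow> x = (0 :: 'a::real_vector)"
  using scaleR_2[of x] by (auto simp: eq_neg_iff_add_eq_0)

lemma orthogonal_group_conj_transpose: "A \<in> orthogonal_group \<Longrightarrow> A\<^sup>\<dagger> \<in> orthogonal_group"
  by (simp add: orthogonal_group_iff orthogonal_groupD)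

lemma cayley_in_orthogonal_group_iff:
  assumes A: "A \<in> orthogonal_group" and Y: "Y \<in> Omega A"
  shows "cayley A Y \<in> orthogonal_group \<longleftrightarrow> Y \<in> tangent_space A"
proof -
  let ?B = "cayley A Y" and ?N = "A + Y" and ?T = "A\<^sup>\<dagger> ** Y + Y\<^sup>\<dagger> ** A"
  have N: "invertible ?N"
    using Y by (simp add: Omega_def)
  \<comment> \<open>Multiplying by \<open>?N\<close> and its adjoint is reversible and clears the
    inverse in \<open>?B\<close>. The two sides then differ only in the sign of
    \<open>?T\<close>.\<close>
  have "?B \<in> orthogonal_group \<longleftrightarrow> ?N\<^sup>\<dagger> ** (?B\<^sup>\<dagger> ** ?B) ** ?N = ?N\<^sup>\<dagger> ** mat 1 ** ?N"
    by (simp only: invertible_cancel N invertible_conj_transpose orthogonal_group_iff)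
  also have "?N\<^sup>\<dagger> ** (?B\<^sup>\<dagger> ** ?B) ** ?N = (?B ** ?N)\<^sup>\<dagger> ** (?B ** ?N)"
    by (simp add: conj_transpose_mult matrix_mul_assoc)
  also have "\<dots> = mat 1 - ?T + Y\<^sup>\<dagger> ** A ** A\<^sup>\<dagger> ** Y"
    unfolding cayley_mult[OF Y]
    by (simp add: conj_transpose_simps mat.left_diff_distrib mat.right_diff_distrib matrix_mul_assoc)
  also have "\<dots> = mat 1 - ?T + Y\<^sup>\<dagger> ** Y"
    using orthogonal_groupD[OF A] by (simp flip: matrix_mul_assoc)
  also have "?N\<^sup>\<dagger> ** mat 1 ** ?N = mat 1 + ?T + Y\<^sup>\<dagger> ** Y"
    using orthogonal_groupD[OF A] by (simp add: conj_transpose_add mat.distrib_left mat.distrib_right)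
  also have "mat 1 - ?T + Y\<^sup>\<dagger> ** Y = mat 1 + ?T + Y\<^sup>\<dagger> ** Y \<longleftrightarrow> ?T = - ?T"
    by (simp only: add_right_cancel diff_conv_add_uminus add_left_cancel) auto
  also have "\<dots> \<longleftrightarrow> ?T = 0"
    by (rule self_eq_minus_iff)
  finally show ?thesis
    by (simp add: tangent_space_def)
qed

text \<open>After right multiplication by \<open>A + Y\<close> both sides equal
  \<open>A - Y ** A\<^sup>\<dagger> ** Y\<close>. This left-hand companion of
  \<open>cayley_mult\<close> is what clears both inverses in a product with \<open>X\<close> in the
  middle.\<close>

lemma mult_cayley:
  assumes A: "A \<in> orthogonal_group" and Y: "Y \<in> Omega A"
  shows "(A + Y) ** cayley A Y = mat 1 - Y ** A\<^sup>\<dagger>"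
proof -
  have "(A + Y) ** cayley A Y ** (A + Y) = (A + Y) ** (mat 1 - A\<^sup>\<dagger> ** Y)"
    using cayley_mult[OF Y] by (simp flip: matrix_mul_assoc)
  also have "\<dots> = A + Y - (A ** A\<^sup>\<dagger> ** Y + Y ** A\<^sup>\<dagger> ** Y)"
    by (simp add: mat.distrib_right mat.right_diff_distrib matrix_mul_assoc)
  also have "\<dots> = A + Y - (Y ** (A\<^sup>\<dagger> ** A) + Y ** A\<^sup>\<dagger> ** Y)"
    using orthogonal_groupD[OF A] by simp
  also have "\<dots> = (mat 1 - Y ** A\<^sup>\<dagger>) ** (A + Y)"
    by (simp add: mat.distrib_left mat.left_diff_distrib matrix_mul_assoc)
  finally show ?thesis
    using Y by (simp add: invertible_cancel Omega_def)
qed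

lemma cayley_quadratic_equation_iff:
  assumes A: "A \<in> orthogonal_group" and Y: "Y \<in> Omega A"
  shows "cayley A Y ** X ** cayley A Y = A\<^sup>\<dagger> ** X ** A\<^sup>\<dagger>
    \<longleftrightarrow> X ** A\<^sup>\<dagger> ** Y + Y ** A\<^sup>\<dagger> ** X = 0"
proof -
  let ?B = "cayley A Y" and ?N = "A + Y" and ?T = "X ** A\<^sup>\<dagger> ** Y + Y ** A\<^sup>\<dagger> ** X"
    and ?Q = "X + Y ** A\<^sup>\<dagger> ** X ** A\<^sup>\<dagger> ** Y"
  note A = orthogonal_groupD[OF A]
  have N: "invertible ?N"
    using Y by (simp add: Omega_def)
  have "?B ** X ** ?B = A\<^sup>\<dagger> ** X ** A\<^sup>\<dagger>
      \<longleftrightarrow> ?N ** (?B ** X ** ?B) ** ?N = ?N ** (A\<^sup>\<dagger> ** X ** A\<^sup>\<dagger>) ** ?N"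
    by (simp only: invertible_cancel N)
  also have "?N ** (?B ** X ** ?B) ** ?N = (?N ** ?B) ** X ** (?B ** ?N)"
    by (simp add: matrix_mul_assoc)
  also have "\<dots> = ?Q - ?T"
    unfolding cayley_mult[OF Y] mult_cayley[OF assms]
    by (simp add: mat.left_diff_distrib mat.right_diff_distrib matrix_mul_assoc)
  \<comment> \<open>The outer factors are \<open>mat 1 + Y ** A\<^sup>\<dagger>\<close> and
    \<open>mat 1 + A\<^sup>\<dagger> ** Y\<close>, those of the other side with \<open>Y\<close>
    negated; hence only the part linear in \<open>Y\<close> changes sign.\<close>
  also have "?N ** (A\<^sup>\<dagger> ** X ** A\<^sup>\<dagger>) ** ?N = (?N ** A\<^sup>\<dagger>) ** X ** (A\<^sup>\<dagger> ** ?N)"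
    by (simp add: matrix_mul_assoc)
  also have "\<dots> = ?Q + ?T"
    by (simp add: A mat.distrib_left mat.distrib_right matrix_mul_assoc)
  also have "?Q - ?T = ?Q + ?T \<longleftrightarrow> ?T = - ?T"
    by (simp only: diff_conv_add_uminus add_left_cancel) auto
  also have "\<dots> \<longleftrightarrow> ?T = 0"
    by (rule self_eq_minus_iff)
  finally show ?thesis .
qed

text \<open>If \<open>A + Y\<close> kills \<open>v\<close>, then \<open>v = - (K *v v)\<close> for
  the skew matrix \<open>K = A\<^sup>\<dagger> ** Y\<close>; but \<open>K *v v\<close> is orthogonal
  to \<open>v\<close>, so \<open>v = 0\<close>.\<close>

lemma tangent_space_subset_Omega:
  fixes A :: "'a::conj_algebra^'n^'n"
  assumes A: "A \<in> orthogonal_group"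
  shows "tangent_space A \<subseteq> Omega A"
proof
  fix Y assume "Y \<in> tangent_space A"
  then have skew: "(A\<^sup>\<dagger> ** Y)\<^sup>\<dagger> = - (A\<^sup>\<dagger> ** Y)"
    by (simp add: tangent_space_def conj_transpose_mult add_eq_0_iff)
  have "invertible (A + Y)"
  proof (rule invertible_if_inj)
    fix v assume "(A + Y) *v v = 0"
    then have "(A\<^sup>\<dagger> ** (A + Y)) *v v = 0"
      by (simp flip: matrix_vector_mul_assoc)
    then have v: "v = - ((A\<^sup>\<dagger> ** Y) *v v)"
      using orthogonal_groupD[OF A]
      by (simp add: mat.distrib_left matrix_vector_mult_add_rdistrib add_eq_0_iff2)
    have neg: "(- M) *v v = - (M *v v)" for M :: "'a^'n^'n"
      using matrix_vector_mult_diff_rdistrib[of 0 M v] by simp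
    have "inner ((A\<^sup>\<dagger> ** Y) *v v) v = - inner v ((A\<^sup>\<dagger> ** Y) *v v)"
      unfolding inner_matrix_vector_mult_left skew by (simp add: neg)
    then have "inner v ((A\<^sup>\<dagger> ** Y) *v v) = 0"
      by (simp add: inner_commute)
    then have "inner v v = 0"
      using arg_cong[OF v, of "inner v"] by simp
    then show "v = 0"
      by simp
  qed
  then show "Y \<in> Omega A"
    by (simp add: Omega_def)
qed

section \<open>The Cayley diffeomorphism onto the critical points\<close>

lemma subspace_S_space:
  fixes A X :: "'a::conj_algebra^'n^'n"
  shows "subspace (S_space X A)"
proof -
  note bl = bounded_bilinear.scaleR_left[OF bounded_bilinear_matrix_mult]
    bounded_bilinear.scaleR_right[OF bounded_bilinear_matrix_mult]
  show ?thesis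
  proof (rule subspaceI)
    show "0 \<in> S_space X A"
      using conj_transpose_scaleR[of 0 "0 :: 'a^'n^'n"] by (simp add: S_space_def tangent_space_def)
  next
    fix Y Z assume "Y \<in> S_space X A" "Z \<in> S_space X A"
    then show "Y + Z \<in> S_space X A"
      by (auto simp: S_space_def tangent_space_def conj_transpose_add mat.distrib_left mat.distrib_right
          add_eq_0_iff2)
  next
    fix r and Y assume "Y \<in> S_space X A"
    then show "r *\<^sub>R Y \<in> S_space X A"
      by (simp add: S_space_def tangent_space_def conj_transpose_scaleR bl flip: scaleR_add_right)
  qed
qed

lemma cayley_diffeomorphism_critical_set:
  fixes A X :: "'a::conj_algebra^'n^'n"
  assumes crit: "A \<in> critical_set X"
  shows "subspace (S_space X A) \<and> S_space X A \<subseteq> Omega (A\<^sup>\<dagger>) \<and>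
    diffeomorphism_betw (cayley (A\<^sup>\<dagger>)) (S_space X A) (critical_set X \<inter> Omega_G A)"
proof -
  let ?S = "S_space X A" and ?T = "critical_set X \<inter> Omega_G A"
    and ?f = "cayley (A\<^sup>\<dagger>)" and ?g = "cayley A"
  have A: "A \<in> orthogonal_group" and AXA: "A ** X ** A = X\<^sup>\<dagger>"
    using crit by (auto simp: critical_set_iff)
  have A': "A\<^sup>\<dagger> \<in> orthogonal_group"
    using A by (rule orthogonal_group_conj_transpose)
  have S: "?S \<subseteq> Omega (A\<^sup>\<dagger>)"
    using tangent_space_subset_Omega[OF A'] by (auto simp: S_space_def)
  have T: "?T \<subseteq> Omega A"
    by (auto simp: Omega_G_def)
  \<comment> \<open>Centred at \<open>A\<^sup>\<dagger>\<close>, the right side of the quadratic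
    equation is \<open>A ** X ** A\<close>, which is \<open>X\<^sup>\<dagger>\<close> because
    \<open>A\<close> is critical. Orthogonality and the equation then match the two conditions
    defining \<open>S_space\<close>.\<close>
  have iff: "?f Y \<in> critical_set X \<longleftrightarrow> Y \<in> ?S" if "Y \<in> Omega (A\<^sup>\<dagger>)" for Y
    using cayley_in_orthogonal_group_iff[OF A' that] cayley_quadratic_equation_iff[OF A' that, of X]
    by (auto simp: critical_set_iff AXA S_space_def)
  note inv_f = cayley_involution[OF A', unfolded conj_transpose_conj_transpose]
  note inv_g = cayley_involution[OF A]
  have fT: "?f Y \<in> ?T" if "Y \<in> ?S" for Y
    using that S inv_f[of Y] iff[of Y] by (auto simp: Omega_G_def critical_set_iff)
  \<comment> \<open>The equivalence is applied at \<open>?g B\<close>, where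
    \<open>?f (?g B) = B\<close> is critical by assumption.\<close>
  have gS: "?g B \<in> ?S" if "B \<in> ?T" for B
    using that T inv_g[of B] iff[of "?g B"] by auto
  have bij: "bij_betw ?f ?S ?T"
    using fT gS S T inv_f inv_g by (intro bij_betw_byWitness[where f' = ?g]) auto
  have "inv_into ?S ?f B = ?g B" if "B \<in> ?T" for B
    using that T gS inv_g bij by (intro inv_into_f_eq) (auto simp: bij_betw_def)
  then have "smooth_map_on ?T (inv_into ?S ?f)"
    using T by (intro smooth_map_on_if_eq_cayley) auto
  moreover have "smooth_map_on ?S ?f"
    using S by (intro smooth_map_on_if_eq_cayley) auto
  ultimately show ?thesis
    using bij S subspace_S_space by (auto simp: diffeomorphism_betw_def)
qed

text \<open>All three ground fields are instances of \<open>conj_algebra\<close>, so the generic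
  result applies to each.\<close>

theorem theorem3:
  shows
    "(\<forall>(X :: real ^ 'n ^ 'n) A. A \<in> critical_set X \<longrightarrow>
        subspace (S_space X A) \<and> S_space X A \<subseteq> Omega (conj_transpose A) \<and>
        diffeomorphism_betw (cayley (conj_transpose A)) (S_space X A) (critical_set X \<inter> Omega_G A)) \<and>
     (\<forall>(X :: complex ^ 'n ^ 'n) A. A \<in> critical_set X \<longrightarrow>
        subspace (S_space X A) \<and> S_space X A \<subseteq> Omega (conj_transpose A) \<and>
        diffeomorphism_betw (cayley (conj_transpose A)) (S_space X A) (critical_set X \<inter> Omega_G A)) \<and>
     (\<forall>(X :: quat ^ 'n ^ 'n) A. A \<in> critical_set X \<longrightarrow>
        subspace (S_space X A) \<and> S_space X A \<subseteq> Omega (conj_transpose A) \<and>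
        diffeomorphism_betw (cayley (conj_transpose A)) (S_space X A) (critical_set X \<inter> Omega_G A))"
  by (intro conjI allI impI) (simp_all only: cayley_diffeomorphism_critical_set)

end
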